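(* Let $f:\mathbb R^n\to\mathbb R^n$ be a smooth vector field, let $\Pi\subset\mathbb R^n$ be a Poincaré section for $x'=f(x)$, let $y\in\Pi$, and let $A=B^{-1}$, where $$B=\left[\,f(y)\mid M\,\right]$$ is the $n\times n$ matrix whose first column is $f(y)$ and whose remaining $n-1$ columns, forming $M$, span $T_y\Pi$. Suppose that the algorithm computePoincareMap described in the context is called with the vector $y$ and the matrix $A$, and that $y\in X_0\cap\Pi$, where $X_0$ is the set computed in the algorithm. Then the interval vectors $\mathbf{Y}$ and $\mathbf{\Delta Y}$ computed in the algorithm satisfy $$\mathbf{Y}+\mathbf{\Delta Y}\subset(\mathbf{\Delta t},0,\ldots,0)+O\left(\operatorname{diam}(X_0)^2\right).$$
   Context: A Poincaré section for $x'=f(x)$ is a connected codimension-one manifold $\Pi\subset\mathbb R^n$ such that $f(x)$ is transversal to $\Pi$ at every $x\in\Pi$. Let $\varphi$ be the local flow of $x'=f(x)$. Let $\Pi_1$ be another section, $X\subset\Pi_1$, and let $\mathcal P:\Pi_1\to\Pi$, $\mathcal P(x)=\varphi(t_{\mathcal P}(x),x)$ with $t_{\mathcal P}(x)=\inf\{t>0:\varphi(t,x)\in\Pi\}$, be the Poincaré map. Interval conventions: intervals are closed and bounded; interval vectors (matrices) are products of closed intervals; arithmetic operations on intervals, interval vectors and interval matrices are the standard interval operations; $[S]_I$ denotes the interval hull of a bounded set $S$ (the smallest product of closed intervals containing $S$); $[g]$ denotes a fixed interval extension of a function $g$, i.e. $[g](\mathbf{v})$ is an interval vector (matrix) containing $g(\mathbf{v})$.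 Algorithm computePoincareMap. Input: an interval $[t_1,t_2]\supset t_{\mathcal P}(X)$; a set $X_1\supset\varphi(t_1,X)$; $f$; a vector $y$; a matrix $A$. It computes: - an interval vector $\mathbf{e}\supset\varphi([0,t_2-t_1],X_1)$; - $t_0=(t_1+t_2)/2$ and the interval $\mathbf{\Delta t}=[t_1,t_2]-t_0$; - a bounded convex set $X_0\supset\varphi(t_0-t_1,X_1)$; - an interval vector $\mathbf{Y_0}\supset A(X_0-y)$; - $\mathbf{Y}=\mathbf{v}\cdot\mathbf{\Delta t}$, where $\mathbf{v}$ is an interval vector enclosing $A f(X_0)$, obtained by intersecting direct interval evaluation with the mean value form, so that $\mathbf{v}\subset\left[A f(x_0)+A\,[Df]([X_0]_I)\,\Delta X_0\right]_I$, where $x_0=\operatorname{mid}(X_0)$ is the midpoint of $[X_0]_I$ and $\Delta X_0=X_0-x_0$; - $\mathbf{\Delta Y}=\tfrac12 A\cdot[Df](\mathbf{e})\cdot[f](\mathbf{e})\cdot\mathbf{\Delta t}^2$. The values $f(x_0)$ and $f(y)$ are assumed to be evaluated exactly (no rounding). Asymptotic convention: the estimate concerns all calls of the algorithm with fixed $f,\Pi,y,A$ for which $\operatorname{diam}(\mathbf{\Delta t})\le K\operatorname{diam}(X_0)$ for a fixed constant $K$ (i.e. $\operatorname{diam}(\mathbf{\Delta t})\in O(\operatorname{diam}(X_0))$) and for which the entries of the enclosures $[Df]([X_0]_I)$, $[Df](\mathbf{e})$, $[f](\mathbf{e})$ are bounded in absolute value by a fixed constant $L$. The displayed inclusion means: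 there is a constant $C$, depending only on $n,A,K,L$, such that for every such call and every $w\in\mathbf{Y}+\mathbf{\Delta Y}$ there is $\tau\in\mathbf{\Delta t}$ with $\|w-(\tau,0,\ldots,0)\|\le C\operatorname{diam}(X_0)^2$. *)

theory Defs
  imports "HOL-Analysis.Analysis" "HOL-Library.Interval"
begin

section \<open>Smooth maps, hypersurfaces and Poincare sections\<close>

text \<open>Class $C^k$ on an open set, by iterated directional derivatives.\<close>

primrec Ck_on ::
  "nat \<Rightarrow> 'a::real_normed_vector set \<Rightarrow> ('a \<Rightarrow> 'b::real_normed_vector) \<Rightarrow> bool"
where
  "Ck_on 0 U g \<longleftrightarrow> continuous_on U g"
| "Ck_on (Suc k) U g \<longleftrightarrow>
     (\<forall>x\<in>U. g differentiable (at x)) \<and>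
     (\<forall>v. Ck_on k U (\<lambda>x. frechet_derivative g (at x) v))"

definition smooth_on :: "'a::real_normed_vector set \<Rightarrow> ('a \<Rightarrow> 'b::real_normed_vector) \<Rightarrow> bool"
  where "smooth_on U g \<longleftrightarrow> (\<forall>k. Ck_on k U g)"

definition first_index :: "'n::{finite,linorder}"
  where "first_index = Min UNIV"

text \<open>Embedded codimension-one submanifold, by slice charts. Only class $C^1$ is required,
  which is what tangent spaces need; every smooth hypersurface qualifies.\<close>

definition hypersurface :: "(real ^ 'n::{finite,linorder}) set \<Rightarrow> bool"
  where "hypersurface S \<longleftrightarrow>
    (\<forall>p\<in>S. \<exists>U (V :: (real ^ 'n::{finite,linorder}) set) h k. open U \<and> p \<in> U \<and> open V \<and>
       homeomorphism U V h k \<and> Ck_on 1 U h \<and> Ck_on 1 V k \<and>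
       h ` (S \<inter> U) = V \<inter> {z. z $ first_index = 0})"

text \<open>Velocities of $C^1$ curves that run in \<open>S\<close> and pass through \<open>p\<close> at time 0.\<close>

definition tangent_space :: "'a::real_normed_vector set \<Rightarrow> 'a \<Rightarrow> 'a set"
  where "tangent_space S p =
    {u. \<exists>e>0. \<exists>c. Ck_on 1 {-e<..<e} c \<and> c ` {-e<..<e} \<subseteq> S \<and> c 0 = p \<and>
          (c has_vector_derivative u) (at (0::real))}"

text \<open>For a hypersurface, transversality of \<open>f x\<close> means that \<open>f x\<close> is not tangent.\<close>

definition poincare_section ::
  "(real ^ 'n::{finite,linorder} \<Rightarrow> real ^ 'n::{finite,linorder}) \<Rightarrow>
   (real ^ 'n::{finite,linorder}) set \<Rightarrow> bool"
  where "poincare_section f S \<longleftrightarrow>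
    connected S \<and> hypersurface S \<and> (\<forall>x\<in>S. f x \<notin> tangent_space S x)"


section \<open>Local flow and Poincare map\<close>

definition solution_on ::
  "('a::real_normed_vector \<Rightarrow> 'a) \<Rightarrow> 'a \<Rightarrow> real set \<Rightarrow> (real \<Rightarrow> 'a) \<Rightarrow> bool"
  where "solution_on f x I u \<longleftrightarrow>
    open I \<and> is_interval I \<and> 0 \<in> I \<and> u 0 = x \<and>
    (\<forall>t\<in>I. (u has_vector_derivative f (u t)) (at t))"

definition flow_dom :: "('a::real_normed_vector \<Rightarrow> 'a) \<Rightarrow> 'a \<Rightarrow> real set"
  where "flow_dom f x = {t. \<exists>I u. solution_on f x I u \<and> t \<in> I}"

text \<open>Meaningful only for \<open>t \<in> flow_dom f x\<close>.\<close>

definition flow :: "('a::real_normed_vector \<Rightarrow> 'a) \<Rightarrow> real \<Rightarrow> 'a \<Rightarrow> 'a"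
  where "flow f t x = (THE z. \<exists>I u. solution_on f x I u \<and> t \<in> I \<and> u t = z)"

text \<open>$\varphi(T, S) \subseteq E$, the flow being defined on all of $T \times S$.\<close>

definition flow_enclosed ::
  "('a::real_normed_vector \<Rightarrow> 'a) \<Rightarrow> real set \<Rightarrow> 'a set \<Rightarrow> 'a set \<Rightarrow> bool"
  where "flow_enclosed f T S E \<longleftrightarrow> (\<forall>x\<in>S. \<forall>t\<in>T. t \<in> flow_dom f x \<and> flow f t x \<in> E)"

definition return_times :: "('a::real_normed_vector \<Rightarrow> 'a) \<Rightarrow> 'a set \<Rightarrow> 'a \<Rightarrow> real set"
  where "return_times f S x = {t. t > 0 \<and> t \<in> flow_dom f x \<and> flow f t x \<in> S}"

definition poincare_time :: "('a::real_normed_vector \<Rightarrow> 'a) \<Rightarrow> 'a set \<Rightarrow> 'a \<Rightarrow> real"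
  where "poincare_time f S x = Inf (return_times f S x)"

definition poincare_map :: "('a::real_normed_vector \<Rightarrow> 'a) \<Rightarrow> 'a set \<Rightarrow> 'a \<Rightarrow> 'a"
  where "poincare_map f S x = flow f (poincare_time f S x) x"

definition poincare_map_defined ::
  "('a::real_normed_vector \<Rightarrow> 'a) \<Rightarrow> 'a set \<Rightarrow> 'a set \<Rightarrow> bool"
  where "poincare_map_defined f S1 S \<longleftrightarrow>
    (\<forall>x\<in>S1. return_times f S x \<noteq> {} \<and> poincare_time f S x \<in> flow_dom f x \<and>
             poincare_map f S x \<in> S)"


section \<open>Interval vectors and matrices\<close>

type_synonym 'n ivec = "(real interval, 'n) vec"
type_synonym 'n imat = "((real interval, 'n) vec, 'n) vec"

definition ivec_set :: "'n::finite ivec \<Rightarrow> (real ^ 'n) set"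
  where "ivec_set V = {x. \<forall>i. x $ i \<in> set_of (V $ i)}"

definition imat_set :: "'n::finite imat \<Rightarrow> (real ^ 'n ^ 'n) set"
  where "imat_set M = {A. \<forall>i j. A $ i $ j \<in> set_of (M $ i $ j)}"

definition imat_of :: "real ^ 'n::finite ^ 'n \<Rightarrow> 'n imat"
  where "imat_of A = (\<chi> i j. interval_of (A $ i $ j))"

text \<open>The library products \<open>**\<close> and \<open>*v\<close> need a semiring, which intervals are not.\<close>

definition imat_mult :: "'n::finite imat \<Rightarrow> 'n imat \<Rightarrow> 'n imat"
  where "imat_mult M N = (\<chi> i j. \<Sum>k\<in>UNIV. M $ i $ k * N $ k $ j)"

definition imat_vec :: "'n::finite imat \<Rightarrow> 'n ivec \<Rightarrow> 'n ivec"
  where "imat_vec M V = (\<chi> i. \<Sum>k\<in>UNIV. M $ i $ k * V $ k)"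

definition ivec_scale :: "'n::finite ivec \<Rightarrow> real interval \<Rightarrow> 'n ivec"
  where "ivec_scale V T = (\<chi> i. V $ i * T)"

definition interval_hull :: "(real ^ 'n::finite) set \<Rightarrow> 'n ivec"
  where "interval_hull S = (\<chi> i. Ivl (INF x\<in>S. x $ i) (SUP x\<in>S. x $ i))"

lemma Ivl_bounds: "a \<le> b \<Longrightarrow> lower (Ivl a b) = a" "upper (Ivl a b) = b" for a b :: real
  by (simp_all add: lower.rep_eq upper.rep_eq Ivl.rep_eq min_absorb1)

lemma interval_hull_bounds:
  fixes S :: "(real ^ 'n::finite) set"
  assumes "bounded S" "x \<in> S"
  shows "lower (interval_hull S $ i) = (INF x\<in>S. x $ i)"
    and "upper (interval_hull S $ i) = (SUP x\<in>S. x $ i)"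
    and "(INF x\<in>S. x $ i) \<le> x $ i" and "x $ i \<le> (SUP x\<in>S. x $ i)"
proof -
  have bnd: "bounded ((\<lambda>x. x $ i) ` S)"
    using assms(1) by (rule bounded_component_cart)
  show lo: "(INF x\<in>S. x $ i) \<le> x $ i"
    by (rule cINF_lower[OF bounded_imp_bdd_below[OF bnd] assms(2)])
  show up: "x $ i \<le> (SUP x\<in>S. x $ i)"
    by (rule cSUP_upper[OF assms(2) bounded_imp_bdd_above[OF bnd]])
  show "lower (interval_hull S $ i) = (INF x\<in>S. x $ i)"
    using order_trans[OF lo up] by (simp add: interval_hull_def Ivl_bounds)
  show "upper (interval_hull S $ i) = (SUP x\<in>S. x $ i)"
    by (simp add: interval_hull_def Ivl_bounds)
qed

lemma subset_interval_hull:
  assumes "bounded S"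
  shows "S \<subseteq> ivec_set (interval_hull S)"
  using interval_hull_bounds[OF assms] by (simp add: ivec_set_def set_of_eq subset_iff)

lemma interval_hull_least:
  assumes "bounded S" "S \<noteq> {}" "S \<subseteq> ivec_set V"
  shows "ivec_set (interval_hull S) \<subseteq> ivec_set V"
proof
  fix z assume z: "z \<in> ivec_set (interval_hull S)"
  obtain x where x: "x \<in> S" using assms(2) by blast
  have bnd: "lower (V $ i) \<le> u $ i" "u $ i \<le> upper (V $ i)" if "u \<in> S" for u i
    using subsetD[OF assms(3) that] by (simp_all add: ivec_set_def set_of_eq)
  have lo: "lower (V $ i) \<le> (INF x\<in>S. x $ i)" for i
    by (rule cINF_greatest[OF assms(2)]) (rule bnd)
  have up: "(SUP x\<in>S. x $ i) \<le> upper (V $ i)" for i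
    by (rule cSUP_least[OF assms(2)]) (rule bnd)
  have "(INF x\<in>S. x $ i) \<le> z $ i" "z $ i \<le> (SUP x\<in>S. x $ i)" for i
    using z unfolding interval_hull_bounds(1,2)[OF assms(1) x, symmetric]
    by (simp_all add: ivec_set_def set_of_eq)
  then show "z \<in> ivec_set V"
    using order_trans[OF lo] order_trans[OF _ up] by (simp add: ivec_set_def set_of_eq)
qed

definition ivec_mid :: "'n::finite ivec \<Rightarrow> real ^ 'n"
  where "ivec_mid V = (\<chi> i. (lower (V $ i) + upper (V $ i)) / 2)"

definition ivec_extension :: "(real ^ 'n::finite \<Rightarrow> real ^ 'n) \<Rightarrow> ('n ivec \<Rightarrow> 'n ivec) \<Rightarrow> bool"
  where "ivec_extension g F \<longleftrightarrow> (\<forall>V. g ` ivec_set V \<subseteq> ivec_set (F V))"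

definition imat_extension ::
  "(real ^ 'n::finite \<Rightarrow> real ^ 'n ^ 'n) \<Rightarrow> ('n ivec \<Rightarrow> 'n imat) \<Rightarrow> bool"
  where "imat_extension g F \<longleftrightarrow> (\<forall>V. g ` ivec_set V \<subseteq> imat_set (F V))"

definition ivec_bounded :: "real \<Rightarrow> 'n::finite ivec \<Rightarrow> bool"
  where "ivec_bounded L V \<longleftrightarrow> (\<forall>i. \<forall>a \<in> set_of (V $ i). \<bar>a\<bar> \<le> L)"

definition imat_bounded :: "real \<Rightarrow> 'n::finite imat \<Rightarrow> bool"
  where "imat_bounded L M \<longleftrightarrow> (\<forall>i j. \<forall>a \<in> set_of (M $ i $ j). \<bar>a\<bar> \<le> L)"


section \<open>The algorithm\<close>

text \<open>The set $A f(x_0) + A\,[Df]([X_0]_I)\,\Delta X_0$, where $\Delta X_0 = X_0 - x_0$ and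
  $x_0$ is the midpoint of $[X_0]_I$.\<close>

definition mean_value_set ::
  "(real ^ 'n::finite \<Rightarrow> real ^ 'n) \<Rightarrow> ('n ivec \<Rightarrow> 'n imat) \<Rightarrow> real ^ 'n ^ 'n \<Rightarrow>
   (real ^ 'n) set \<Rightarrow> (real ^ 'n) set"
  where "mean_value_set f DF A X0 =
    (let x0 = ivec_mid (interval_hull X0)
     in {A *v f x0 + N *v (x - x0) | N x.
           N \<in> imat_set (imat_mult (imat_of A) (DF (interval_hull X0))) \<and> x \<in> X0})"

definition centered :: "real interval \<Rightarrow> real interval"
  where "centered T = T - interval_of ((lower T + upper T) / 2)"

text \<open>\<open>F\<close> and \<open>DF\<close> are the interval extensions $[f]$, $[Df]$; the input interval $[t_1,t_2]$
  is \<open>T\<close>, so that \<open>centered T\<close> is $\mathbf{\Delta t}$. Interval matrix products are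
  not associative, so $\mathbf{\Delta Y}$ depends on the order of evaluation: here the
  matrix-vector product is taken first, and the library power \<open>_ ^ 2\<close> is the product of the interval with
  itself. Evaluating $(A \cdot [Df](\mathbf e)) \cdot [f](\mathbf e)$ or using the range of
  $t \mapsto t^2$ instead gives a subset of this enclosure, for
  which the estimate then holds as well.\<close>

definition computePoincareMap ::
  "(real ^ 'n::finite \<Rightarrow> real ^ 'n) \<Rightarrow> ('n ivec \<Rightarrow> 'n ivec) \<Rightarrow> ('n ivec \<Rightarrow> 'n imat) \<Rightarrow>
   (real ^ 'n) set \<Rightarrow> (real ^ 'n) set \<Rightarrow>
   real interval \<Rightarrow> (real ^ 'n) set \<Rightarrow> real ^ 'n \<Rightarrow> real ^ 'n ^ 'n \<Rightarrow>
   'n ivec \<Rightarrow> (real ^ 'n) set \<Rightarrow> 'n ivec \<Rightarrow> 'n ivec \<Rightarrow> 'n ivec \<Rightarrow> 'n ivec \<Rightarrow> bool"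
  where "computePoincareMap f F DF S X T X1 y A e X0 Y0 v Y DY \<longleftrightarrow>
    (let t1 = lower T; t2 = upper T; t0 = (t1 + t2) / 2; Dt = centered T in
      poincare_time f S ` X \<subseteq> set_of T \<and>
      flow_enclosed f {t1} X X1 \<and>
      flow_enclosed f {0..t2 - t1} X1 (ivec_set e) \<and>
      bounded X0 \<and> convex X0 \<and> flow_enclosed f {t0 - t1} X1 X0 \<and>
      (\<lambda>x. A *v (x - y)) ` X0 \<subseteq> ivec_set Y0 \<and>
      (\<lambda>x. A *v f x) ` X0 \<subseteq> ivec_set v \<and>
      ivec_set v \<subseteq> ivec_set (interval_hull (mean_value_set f DF A X0)) \<and>
      Y = ivec_scale v Dt \<and>
      DY = ivec_scale
             (imat_vec (imat_of ((1/2) *\<^sub>R A)) (imat_vec (DF e) (F e))) (Dt ^ 2))"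

end

theory Submission
  imports Defs
begin

text \<open>
  A slice chart shows that the tangent space of the section has dimension at least \<open>n - 1\<close>;
  as \<open>f y\<close> is not tangent, \<open>B\<close> is invertible and \<open>A f(y)\<close> is the first unit vector.
  The mean value theorem between \<open>y\<close> and the midpoint \<open>x\<^sub>0\<close>, together with the mean value form,
  puts every component of \<open>v\<close> within \<open>O(diam X\<^sub>0)\<close> of that unit vector. Multiplying by
  \<open>\<Delta>t\<close>, an interval of radius \<open>O(diam X\<^sub>0)\<close>, gives the estimate for \<open>Y\<close>, and \<open>\<Delta>Y\<close> is
  of second order because it carries the factor \<open>\<Delta>t\<^sup>2\<close>.
\<close>

section \<open>Tangent spaces of hypersurfaces\<close>

text \<open>Chain rule along a straight line. With \<open>k\<close> an inverse slice chart, this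
  produces the curves that witness membership in \<open>tangent_space\<close>, together with their
  velocities.\<close>

lemma Ck_on_1_line:
  fixes k :: "'a::real_normed_vector \<Rightarrow> 'b::real_normed_vector"
  assumes k: "Ck_on 1 V k" and mem: "\<And>t. t \<in> I \<Longrightarrow> q + t *\<^sub>R z \<in> V"
  shows "Ck_on 1 I (\<lambda>t::real. k (q + t *\<^sub>R z))"
    and "\<And>t. t \<in> I \<Longrightarrow> ((\<lambda>t. k (q + t *\<^sub>R z)) has_vector_derivative
           frechet_derivative k (at (q + t *\<^sub>R z)) z) (at t)"
proof -
  have D: "((\<lambda>t. k (q + t *\<^sub>R z)) has_derivative
      (\<lambda>s. s *\<^sub>R frechet_derivative k (at (q + t *\<^sub>R z)) z)) (at t)" if "t \<in> I" for t
  proof -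
    have "k differentiable (at (q + t *\<^sub>R z))"
      using k mem[OF that] by simp
    then have dk: "(k has_derivative frechet_derivative k (at (q + t *\<^sub>R z))) (at (q + t *\<^sub>R z))"
      by (simp add: frechet_derivative_works)
    have "((\<lambda>t. q + t *\<^sub>R z) has_derivative (\<lambda>s. s *\<^sub>R z)) (at t)"
      by (auto intro!: derivative_eq_intros)
    from has_derivative_compose[OF this dk] show ?thesis
      by (simp add: linear_scale[OF has_derivative_linear[OF dk]])
  qed
  then show "\<And>t. t \<in> I \<Longrightarrow> ((\<lambda>t. k (q + t *\<^sub>R z)) has_vector_derivative
      frechet_derivative k (at (q + t *\<^sub>R z)) z) (at t)"
    by (simp add: has_vector_derivative_def)
  \<comment> \<open>\<open>Ck_on 1\<close> asks for continuity of the derivative in every direction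
    \<open>s\<close>; on the real line this is \<open>s\<close> times the velocity.\<close>
  have F: "frechet_derivative (\<lambda>t. k (q + t *\<^sub>R z)) (at t) s
      = s *\<^sub>R frechet_derivative k (at (q + t *\<^sub>R z)) z" if "t \<in> I" for t s
    using frechet_derivative_at[OF D[OF that]] by (metis (no_types))
  have "continuous_on V (\<lambda>x. frechet_derivative k (at x) z)"
    using k by simp
  then have "continuous_on I (\<lambda>t. frechet_derivative k (at (q + t *\<^sub>R z)) z)"
    by (rule continuous_on_compose2) (use mem in \<open>auto intro!: continuous_intros\<close>)
  then have "continuous_on I (\<lambda>t. s *\<^sub>R frechet_derivative k (at (q + t *\<^sub>R z)) z)" for s
    by (intro continuous_intros)
  then have "continuous_on I (\<lambda>t. frechet_derivative (\<lambda>t. k (q + t *\<^sub>R z)) (at t) s)" for s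
    using F by (simp cong: continuous_on_cong)
  then show "Ck_on 1 I (\<lambda>t::real. k (q + t *\<^sub>R z))"
    using D by (auto simp: differentiable_def)
qed

text \<open>The derivative of the inverse chart is injective and maps the slice hyperplane
  \<open>H\<close> into the tangent vectors, since the inverse chart carries short segments in
  \<open>H\<close> to curves in \<open>S\<close>. As \<open>dim\<close> is monotone on arbitrary
  sets, this inclusion suffices.\<close>

lemma dim_tangent_space_hypersurface:
  fixes S :: "(real ^ 'n::{finite,linorder}) set"
  assumes "hypersurface S" "p \<in> S"
  shows "CARD('n) - 1 \<le> dim (tangent_space S p)"
proof -
  obtain U h k and V :: "(real ^ 'n::{finite,linorder}) set" where UV: "open U" "p \<in> U" "open V"
    and hom: "homeomorphism U V h k" and C1: "Ck_on 1 U h" "Ck_on 1 V k"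
    and sl: "h ` (S \<inter> U) = V \<inter> {z. z $ first_index = 0}"
    using bspec[OF assms(1)[unfolded hypersurface_def] assms(2)] by (elim exE conjE) (rule that)
  define q where "q = h p"
  define H :: "(real ^ 'n::{finite,linorder}) set" where "H = {z. axis first_index 1 \<bullet> z = 0}"
  have H: "z \<in> H \<longleftrightarrow> z $ first_index = 0" for z
    by (simp add: H_def inner_axis')
  have q: "q \<in> V" "q \<in> H" "k q = p"
    using sl UV assms hom by (auto simp: q_def H homeomorphism_def)
  let ?D = "frechet_derivative k (at q)"
  have dk: "(k has_derivative ?D) (at q)"
    using C1(2) q(1) by (simp add: frechet_derivative_works)
  have dh: "(h has_derivative frechet_derivative h (at p)) (at (k q))"
    using C1(1) UV q(3) by (simp add: frechet_derivative_works)
  \<comment> \<open>Differentiating \<open>h (k x) = x\<close> on the open set \<open>V\<close>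
    gives a left inverse of \<open>?D\<close>.\<close>
  have "((\<lambda>x. h (k x)) has_derivative (\<lambda>x. frechet_derivative h (at p) (?D x))) (at q)"
    by (rule has_derivative_compose[OF dk dh])
  then have "((\<lambda>x. x) has_derivative (\<lambda>x. frechet_derivative h (at p) (?D x))) (at q)"
    by (rule has_derivative_transform_within_open[OF _ UV(3) q(1)])
       (use hom in \<open>auto simp: homeomorphism_def\<close>)
  then have "(\<lambda>x. frechet_derivative h (at p) (?D x)) = (\<lambda>x. x)"
    using has_derivative_ident by (rule has_derivative_unique)
  then have inj: "inj ?D"
    by (metis injI)
  have lin: "linear ?D"
    using dk by (rule has_derivative_linear)
  have "?D ` H \<subseteq> tangent_space S p"
  proof
    fix u assume "u \<in> ?D ` H"
    then obtain z where z: "z \<in> H" "u = ?D z" by blast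
    \<comment> \<open>Openness of \<open>V\<close> provides an \<open>e\<close> for which the
      segment through \<open>q\<close> in direction \<open>z\<close> stays in the chart
      image.\<close>
    have "open ((\<lambda>t::real. q + t *\<^sub>R z) -` V)"
      using UV(3) by (intro open_vimage continuous_intros)
    moreover have "0 \<in> (\<lambda>t::real. q + t *\<^sub>R z) -` V"
      using q(1) by simp
    ultimately obtain e where e: "e > 0" "ball (0::real) e \<subseteq> (\<lambda>t. q + t *\<^sub>R z) -` V"
      by (rule openE)
    have mem: "q + t *\<^sub>R z \<in> V" if "t \<in> {-e<..<e}" for t
      using that e(2) by (auto simp: subset_iff dist_real_def)
    have "k x \<in> S" if x: "x \<in> V" "x $ first_index = 0" for x
    proof -
      have "x \<in> h ` (S \<inter> U)"
        unfolding sl using x by simp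
      then obtain s where "s \<in> S" "s \<in> U" "x = h s"
        by blast
      then show ?thesis
        using homeomorphism_apply1[OF hom] by simp
    qed
    then have "(\<lambda>t. k (q + t *\<^sub>R z)) ` {-e<..<e} \<subseteq> S"
      using mem z(1) q(2) by (auto simp: H)
    moreover have "((\<lambda>t. k (q + t *\<^sub>R z)) has_vector_derivative u) (at 0)"
      using Ck_on_1_line(2)[OF C1(2) mem, of "{-e<..<e}" 0] e(1) z(2) by simp
    ultimately show "u \<in> tangent_space S p"
      unfolding tangent_space_def mem_Collect_eq using e(1) q(3) Ck_on_1_line(1)[OF C1(2) mem, of "{-e<..<e}"]
      by (intro exI[of _ e] exI[of _ "\<lambda>t. k (q + t *\<^sub>R z)"] conjI) simp_all
  qed
  then have "dim (?D ` H) \<le> dim (tangent_space S p)"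
    by (rule dim_subset)
  moreover have "dim (?D ` H) = dim H"
    using lin inj by (simp add: dim_image_eq inj_on_subset)
  moreover have "dim H = CARD('n) - 1"
    unfolding H_def by (subst dim_special_hyperplane) (auto simp: axis_in_Basis_iff)
  ultimately show ?thesis by simp
qed

text \<open>The columns other than \<open>i\<close> span at least \<open>n - 1\<close> dimensions
  and column \<open>i\<close> lies outside their span, so together the columns span the whole
  space.\<close>

lemma invertible_transversal_frame:
  fixes B :: "real ^ 'n::{finite,linorder} ^ 'n::{finite,linorder}"
  assumes "hypersurface S" "y \<in> S" "column i B \<notin> tangent_space S y"
    and T: "span {column j B | j. j \<noteq> i} = tangent_space S y"
  shows "invertible B"
proof -
  let ?M = "{column j B | j. j \<noteq> i}"
  have "columns B = insert (column i B) ?M"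
    by (auto simp: columns_def)
  moreover have "dim (insert (column i B) ?M) = dim ?M + 1"
    using assms(3) T by (simp add: dim_insert)
  moreover have "CARD('n) - 1 \<le> dim ?M"
    using dim_tangent_space_hypersurface[OF assms(1,2)] dim_span[of ?M] unfolding T by simp
  ultimately have "CARD('n) \<le> dim (columns B)"
    by simp
  moreover have "dim (columns B) \<le> CARD('n)"
    using dim_subset_UNIV[of "columns B"] by simp
  ultimately have "span (columns B) = UNIV"
    using dim_eq_full[of "columns B"] by simp
  then show ?thesis
    by (simp add: invertible_right_inverse matrix_right_invertible_span_columns span_vec_eq)
qed

text \<open>Column \<open>i\<close> of \<open>B\<close> is \<open>B *v axis i 1\<close>.
  Invertibility guarantees that the matrix picked by the choice operator in
  \<open>matrix_inv\<close> is an inverse.\<close>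

lemma matrix_inv_column:
  fixes B :: "real ^ 'n ^ 'n"
  assumes "invertible B"
  shows "matrix_inv B *v column i B = axis i 1"
proof -
  have "matrix_inv B ** B = mat 1"
    using assms unfolding invertible_def matrix_inv_def by (rule someI2_ex) blast
  then show ?thesis
    by (metis matrix_vector_mul_assoc matrix_vector_mul_lid matrix_vector_mult_basis)
qed

section \<open>Magnitude bounds for interval operations\<close>

text \<open>An upper bound on the magnitude of an interval. Magnitude is subadditive and
  submultiplicative, so such bounds pass through interval arithmetic without case distinctions on
  endpoint signs.\<close>

definition ivl_abs_le :: "real interval \<Rightarrow> real \<Rightarrow> bool"
  where "ivl_abs_le I c \<longleftrightarrow> (\<forall>a\<in>set_of I. \<bar>a\<bar> \<le> c)"

lemma ivl_abs_leD: "ivl_abs_le I c \<Longrightarrow> a \<in> set_of I \<Longrightarrow> \<bar>a\<bar> \<le> c"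
  by (simp add: ivl_abs_le_def)

text \<open>An interval contains its lower endpoint, so the bound dominates some absolute
  value.\<close>

lemma ivl_abs_le_nonneg: "ivl_abs_le I c \<Longrightarrow> 0 \<le> c"
  unfolding ivl_abs_le_def using abs_ge_zero order_trans
  by (metis atLeastAtMost_iff lower_le_upper order_refl set_of_eq)

lemma ivl_abs_le_interval_of [simp]: "ivl_abs_le (interval_of x) c \<longleftrightarrow> \<bar>x\<bar> \<le> c"
  by (auto simp: ivl_abs_le_def set_of_eq)

lemma ivl_abs_le_times:
  assumes "ivl_abs_le I a" "ivl_abs_le J b"
  shows "ivl_abs_le (I * J) (a * b)"
  using assms ivl_abs_le_nonneg[OF assms(1)]
  by (auto simp: ivl_abs_le_def set_of_times abs_mult intro!: mult_mono)

lemma ivl_abs_le_plus: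
  assumes "ivl_abs_le I a" "ivl_abs_le J b"
  shows "ivl_abs_le (I + J) (a + b)"
  using assms by (force simp: ivl_abs_le_def set_of_plus elim!: set_plus_elim)

lemma ivl_abs_le_sum:
  assumes "finite A" "\<And>k. k \<in> A \<Longrightarrow> ivl_abs_le (I k) c"
  shows "ivl_abs_le (\<Sum>k\<in>A. I k) (real (card A) * c)"
  using assms
proof (induction A rule: finite_induct)
  case empty
  then show ?case by (simp add: ivl_abs_le_def set_of_eq)
next
  case (insert x A)
  then have "ivl_abs_le (I x + sum I A) (c + real (card A) * c)"
    by (intro ivl_abs_le_plus) auto
  then show ?case using insert by (simp add: algebra_simps)
qed

lemma ivl_abs_le_imat_vec:
  fixes M :: "'n::finite imat"
  assumes "\<And>i j. ivl_abs_le (M $ i $ j) a" "\<And>j. ivl_abs_le (V $ j) b"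
  shows "ivl_abs_le (imat_vec M V $ i) (real CARD('n) * (a * b))"
  unfolding imat_vec_def using assms by (simp add: ivl_abs_le_sum ivl_abs_le_times)

lemma ivl_abs_le_imat_mult:
  fixes M :: "'n::finite imat"
  assumes "\<And>i j. ivl_abs_le (M $ i $ j) a" "\<And>i j. ivl_abs_le (N $ i $ j) b"
  shows "ivl_abs_le (imat_mult M N $ i $ j) (real CARD('n) * (a * b))"
  unfolding imat_mult_def using assms by (simp add: ivl_abs_le_sum ivl_abs_le_times)

lemma centered_bounds:
  "lower (centered T) = - ((upper T - lower T) / 2)"
  "upper (centered T) = (upper T - lower T) / 2"
  by (simp_all add: centered_def lower_minus upper_minus field_simps)

text \<open>The diameter of a real interval is its length; this turns the hypothesis on the diameter
  of the time interval into a bound on its radius.\<close>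

lemma set_of_centered: "set_of (centered T) = {- (diameter (set_of (centered T)) / 2)..
    diameter (set_of (centered T)) / 2}"
  by (simp add: set_of_eq centered_bounds not_less)

section \<open>Componentwise bounds for real vectors and matrices\<close>

lemma norm_le_card_component:
  fixes x :: "real ^ 'n"
  assumes "\<And>i. \<bar>x $ i\<bar> \<le> c"
  shows "norm x \<le> real CARD('n) * c"
proof -
  have "(\<Sum>i\<in>UNIV. \<bar>x $ i\<bar>) \<le> (\<Sum>i\<in>(UNIV :: 'n set). c)"
    by (rule sum_mono) (rule assms)
  with norm_le_l1_cart[of x] show ?thesis by simp
qed

lemma matrix_vector_mult_component_le:
  fixes M :: "real ^ 'n ^ 'm"
  assumes "\<And>i j. \<bar>M $ i $ j\<bar> \<le> a" "\<And>j. \<bar>x $ j\<bar> \<le> b"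
  shows "\<bar>(M *v x) $ i\<bar> \<le> real CARD('n) * (a * b)"
proof -
  have "0 \<le> a" using order_trans[OF abs_ge_zero assms(1)] .
  then have "\<bar>M $ i $ j * x $ j\<bar> \<le> a * b" for j
    unfolding abs_mult using assms by (intro mult_mono) auto
  then have "\<bar>\<Sum>j\<in>UNIV. M $ i $ j * x $ j\<bar> \<le> (\<Sum>j\<in>(UNIV::'n set). a * b)"
    by (intro order_trans[OF sum_abs] sum_mono) auto
  then show ?thesis
    by (simp add: matrix_vector_mult_def)
qed

section \<open>Enclosure of the vector field and the estimate\<close>

definition ivec_box :: "real ^ 'n::finite \<Rightarrow> real \<Rightarrow> 'n ivec"
  where "ivec_box p c = (\<chi> i. Ivl (p $ i - c) (p $ i + c))"

lemma mem_ivec_box: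
  "0 \<le> c \<Longrightarrow> x \<in> ivec_set (ivec_box p c) \<longleftrightarrow> (\<forall>i. \<bar>x $ i - p $ i\<bar> \<le> c)"
  by (auto simp: ivec_box_def ivec_set_def set_of_eq Ivl_bounds abs_le_iff algebra_simps)

lemma ivec_set_eq_cbox: "ivec_set V = cbox (\<chi> i. lower (V $ i)) (\<chi> i. upper (V $ i))"
  by (auto simp: ivec_set_def set_of_eq mem_box_cart)

lemma bounded_ivec_set: "bounded (ivec_set V)"
  by (simp add: ivec_set_eq_cbox)

lemma convex_ivec_set: "convex (ivec_set V)"
  by (simp add: ivec_set_eq_cbox)

lemma ivec_mid_mem: "ivec_mid V \<in> ivec_set V"
proof -
  have "lower (V $ i) \<le> upper (V $ i)" for i by simp
  then show ?thesis
    by (auto simp: ivec_set_def ivec_mid_def set_of_eq field_simps)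
qed

text \<open>Minimality of the hull, applied to the box as a competitor. Nonemptiness of
  \<open>S\<close> is what makes the infima and suprema in the hull meaningful.\<close>

lemma interval_hull_subset_box:
  assumes "S \<noteq> {}" "0 \<le> c" "\<And>x i. x \<in> S \<Longrightarrow> \<bar>x $ i - p $ i\<bar> \<le> c"
  shows "ivec_set (interval_hull S) \<subseteq> ivec_set (ivec_box p c)"
proof -
  have "S \<subseteq> ivec_set (ivec_box p c)"
    using assms by (auto simp: mem_ivec_box)
  then show ?thesis
    using assms(1) bounded_ivec_set bounded_subset interval_hull_least by blast
qed

text \<open>An interval vector is a product of nonempty intervals, so one coordinate can be
  prescribed and the others filled with lower endpoints.\<close>

lemma ivec_set_component:
  assumes "a \<in> set_of (V $ i)"
  obtains x where "x \<in> ivec_set V" "x $ i = a"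
proof
  show "(\<chi> j. if j = i then a else lower (V $ j)) \<in> ivec_set V"
    using assms by (simp add: ivec_set_def set_of_eq)
qed simp

text \<open>The term with \<open>n ^ 4\<close> bounds \<open>A *v (f x0 - f y)\<close>: one factor
  \<open>n\<close> from applying \<open>A\<close>, two from the operator norm of the Jacobian, one
  from the norm of \<open>x0 - y\<close>. The term with \<open>2 * n ^ 2\<close> bounds
  \<open>N *v (x - x0)\<close>.\<close>

lemma mean_value_enclosure:
  fixes A :: "real ^ 'n::finite ^ 'n::finite"
  assumes diff: "\<And>x. f differentiable (at x)"
    and ext: "imat_extension (\<lambda>x. jacobian f (at x)) DF"
    and X0: "bounded X0" "y \<in> X0"
    and L: "imat_bounded L (DF (interval_hull X0))"
    and a: "\<And>i j. \<bar>A $ i $ j\<bar> \<le> a"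
    and u: "u \<in> ivec_set (interval_hull (mean_value_set f DF A X0))"
  defines "n \<equiv> real CARD('n)"
  shows "\<bar>u $ i - (A *v f y) $ i\<bar> \<le> (n ^ 4 * a * L + 2 * n ^ 2 * a * L) * diameter X0"
proof -
  let ?Q = "interval_hull X0"
  define d where "d = diameter X0"
  define x0 where "x0 = ivec_mid ?Q"
  let ?c = "(n ^ 4 * a * L + 2 * n ^ 2 * a * L) * d"
  have n0: "0 \<le> n" by (simp add: n_def)
  have d0: "0 \<le> d" using X0(1) by (simp add: d_def diameter_ge_0)
  have a0: "0 \<le> a" using order_trans[OF abs_ge_zero a] .
  have DL: "ivl_abs_le (DF ?Q $ i $ j) L" for i j
    using L by (simp add: imat_bounded_def ivl_abs_le_def)
  have L0: "0 \<le> L" using ivl_abs_le_nonneg[OF DL] .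
  have near: "\<bar>x $ i - y $ i\<bar> \<le> d" if "x \<in> X0" for x i
  proof -
    have "\<bar>x $ i - y $ i\<bar> \<le> norm (x - y)"
      using component_le_norm_cart[of "x - y" i] by simp
    also have "\<dots> \<le> d"
      using diameter_bounded_bound[OF X0(1) that X0(2)] by (simp add: d_def dist_norm)
    finally show ?thesis .
  qed
  \<comment> \<open>The midpoint \<open>x0\<close> may lie outside \<open>X0\<close>, so its
    distance to \<open>y\<close> is controlled through the hull.\<close>
  have "ivec_set ?Q \<subseteq> ivec_set (ivec_box y d)"
    using X0(2) d0 near by (intro interval_hull_subset_box) auto
  moreover have x0Q: "x0 \<in> ivec_set ?Q"
    unfolding x0_def by (rule ivec_mid_mem)
  ultimately have x0: "\<bar>x0 $ i - y $ i\<bar> \<le> d" for i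
    using d0 by (auto simp: mem_ivec_box)
  have yQ: "y \<in> ivec_set ?Q"
    using subset_interval_hull[OF X0(1)] X0(2) by blast
  \<comment> \<open>The mean value inequality is applied on the hull: it is convex, contains both
    points, and is where \<open>DF ?Q\<close> encloses the Jacobian.\<close>
  have "norm (f x0 - f y) \<le> (n * n * L) * norm (x0 - y)"
  proof (rule differentiable_bound[OF convex_ivec_set _ _ x0Q yQ])
    fix x assume x: "x \<in> ivec_set ?Q"
    show "(f has_derivative (*v) (jacobian f (at x))) (at x within ivec_set ?Q)"
      using diff[of x] by (simp add: has_derivative_at_withinI jacobian_works)
    have "jacobian f (at x) \<in> imat_set (DF ?Q)"
      using ext x unfolding imat_extension_def by blast
    then have "\<bar>jacobian f (at x) $ i $ j\<bar> \<le> L" for i j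
      by (auto simp: imat_set_def intro: ivl_abs_leD[OF DL])
    then show "onorm ((*v) (jacobian f (at x))) \<le> n * n * L"
      unfolding n_def by (rule onorm_le_matrix_component)
  qed
  also have "norm (x0 - y) \<le> n * d"
    unfolding n_def using x0 by (intro norm_le_card_component) simp
  finally have fb: "norm (f x0 - f y) \<le> n * n * L * (n * d)"
    using n0 L0 by (simp add: mult_left_mono)
  have "\<bar>(A *v (f x0 - f y)) $ i\<bar> \<le> n * (a * (n * n * L * (n * d)))" for i
    unfolding n_def
    by (rule matrix_vector_mult_component_le[OF a],
        rule order_trans[OF component_le_norm_cart fb[unfolded n_def]])
  then have Af: "\<bar>(A *v f x0) $ i - (A *v f y) $ i\<bar> \<le> n ^ 4 * a * L * d" for i
    by (simp add: matrix_vector_mult_diff_distrib power_numeral_reduce algebra_simps)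
  have "\<bar>s $ i - (A *v f y) $ i\<bar> \<le> ?c" if smv: "s \<in> mean_value_set f DF A X0" for s i
  proof -
    obtain N x where s: "s = A *v f x0 + N *v (x - x0)" and x: "x \<in> X0"
      and N: "N \<in> imat_set (imat_mult (imat_of A) (DF ?Q))"
      using smv unfolding mean_value_set_def x0_def Let_def by blast
    have "ivl_abs_le (imat_mult (imat_of A) (DF ?Q) $ i $ j) (n * (a * L))" for i j
      unfolding n_def by (rule ivl_abs_le_imat_mult) (simp_all add: imat_of_def a DL)
    moreover have "N $ i $ j \<in> set_of (imat_mult (imat_of A) (DF ?Q) $ i $ j)" for i j
      using N by (simp add: imat_set_def)
    ultimately have "\<bar>N $ i $ j\<bar> \<le> n * (a * L)" for i j
      by (rule ivl_abs_leD)
    \<comment> \<open>One \<open>d\<close> from \<open>x\<close> to \<open>y\<close> and another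
      from \<open>y\<close> to \<open>x0\<close>.\<close>
    moreover have "\<bar>(x - x0) $ j\<bar> \<le> 2 * d" for j
      using near[OF x, of j] x0[of j] by simp
    ultimately have "\<bar>(N *v (x - x0)) $ i\<bar> \<le> n * (n * (a * L) * (2 * d))"
      unfolding n_def by (rule matrix_vector_mult_component_le)
    then show ?thesis
      using Af[of i] by (simp add: s power2_eq_square algebra_simps)
  qed
  moreover have "mean_value_set f DF A X0 \<noteq> {}"
  proof -
    have "(\<chi> i j. lower (imat_mult (imat_of A) (DF ?Q) $ i $ j))
        \<in> imat_set (imat_mult (imat_of A) (DF ?Q))"
      by (simp add: imat_set_def set_of_eq)
    then show ?thesis
      using X0(2) unfolding mean_value_set_def Let_def by blast
  qed
  moreover have c0: "0 \<le> ?c"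
    using n0 a0 L0 d0 by simp
  ultimately have "u \<in> ivec_set (ivec_box (A *v f y) ?c)"
    using interval_hull_subset_box u by blast
  then show ?thesis
    using c0 by (simp add: mem_ivec_box d_def)
qed

section \<open>The second-order estimate\<close>

theorem theorem10:
  fixes A :: "real ^ 'n::{finite,linorder} ^ 'n::{finite,linorder}" and K L :: real
  shows "\<exists>C::real. \<forall>f S S1 y B F DF X T X1 e X0 Y0 v Y DY.
      smooth_on UNIV f \<longrightarrow>
      poincare_section f S \<longrightarrow>
      poincare_section f S1 \<longrightarrow> poincare_map_defined f S1 S \<longrightarrow> X \<subseteq> S1 \<longrightarrow>
      y \<in> S \<longrightarrow>
      column first_index B = f y \<longrightarrow>
      span {column j B | j. j \<noteq> first_index} = tangent_space S y \<longrightarrow>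
      A = matrix_inv B \<longrightarrow>
      ivec_extension f F \<longrightarrow>
      imat_extension (\<lambda>x. jacobian f (at x)) DF \<longrightarrow>
      computePoincareMap f F DF S X T X1 y A e X0 Y0 v Y DY \<longrightarrow>
      y \<in> X0 \<inter> S \<longrightarrow>
      diameter (set_of (centered T)) \<le> K * diameter X0 \<longrightarrow>
      imat_bounded L (DF (interval_hull X0)) \<longrightarrow>
      imat_bounded L (DF e) \<longrightarrow>
      ivec_bounded L (F e) \<longrightarrow>
      (\<forall>w \<in> ivec_set (Y + DY). \<exists>\<tau> \<in> set_of (centered T).
         norm (w - \<tau> *\<^sub>R axis first_index 1) \<le> C * (diameter X0)\<^sup>2)"
proof -
  \<comment> \<open>All constants are fixed before the call and depend only on \<open>n\<close>,
    \<open>A\<close> and \<open>L\<close>: \<open>a\<close> dominates the entries of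
    \<open>A\<close>, \<open>c\<close> is the constant of \<open>mean_value_enclosure\<close>, and
    \<open>b\<close> bounds the vector that \<open>DY\<close> multiplies by the squared time
    interval.\<close>
  define a where "a = (\<Sum>i\<in>UNIV. \<Sum>j\<in>UNIV. \<bar>A $ i $ j\<bar>)"
  define n where "n = real CARD('n)"
  define c where "c = n ^ 4 * a * L + 2 * n ^ 2 * a * L"
  define b where "b = n * (a * (n * (L * L)))"
  have a: "\<bar>A $ i $ j\<bar> \<le> a" for i j
  proof -
    have "\<bar>A $ i $ j\<bar> \<le> (\<Sum>j\<in>UNIV. \<bar>A $ i $ j\<bar>)"
      by (rule member_le_sum) auto
    also have "\<dots> \<le> a"
      unfolding a_def by (rule member_le_sum) (auto intro: sum_nonneg)
    finally show ?thesis .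
  qed
  have a0: "0 \<le> a" using order_trans[OF abs_ge_zero a] .
  have n0: "0 \<le> n" by (simp add: n_def)
  show ?thesis
  \<comment> \<open>The summand \<open>c * \<bar>K\<bar>\<close> accounts for \<open>Y\<close> and
    \<open>b * K\<^sup>2\<close> for \<open>DY\<close>; the factor \<open>n\<close> passes from
    components to the norm.\<close>
  proof (intro exI[of _ "n * (c * \<bar>K\<bar> + b * K\<^sup>2)"] allI impI ballI)
    fix f :: "real ^ 'n::{finite,linorder} \<Rightarrow> real ^ 'n::{finite,linorder}" and S S1 :: "(real ^ 'n::{finite,linorder}) set" and y :: "real ^ 'n::{finite,linorder}"
      and B :: "real ^ 'n::{finite,linorder} ^ 'n::{finite,linorder}" and F DF T X X1 X0 w and e Y0 v Y DY :: "('n::{finite,linorder}) ivec"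
    assume sm: "smooth_on UNIV f" and sec: "poincare_section f S" and y: "y \<in> S"
      and col: "column first_index B = f y"
      and sp: "span {column j B | j. j \<noteq> first_index} = tangent_space S y"
      and AB: "A = matrix_inv B"
      and ext: "imat_extension (\<lambda>x. jacobian f (at x)) DF"
      and alg: "computePoincareMap f F DF S X T X1 y A e X0 Y0 v Y DY"
      and yX: "y \<in> X0 \<inter> S"
      and K: "diameter (set_of (centered T)) \<le> K * diameter X0"
      and L: "imat_bounded L (DF (interval_hull X0))" "imat_bounded L (DF e)"
        "ivec_bounded L (F e)"
      and w: "w \<in> ivec_set (Y + DY)"
    define d where "d = diameter X0"
    define r where "r = diameter (set_of (centered T)) / 2"
    have bX: "bounded X0"
      and v: "ivec_set v \<subseteq> ivec_set (interval_hull (mean_value_set f DF A X0))"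
      and Y: "Y = ivec_scale v (centered T)"
      and DY: "DY = ivec_scale (imat_vec (imat_of ((1/2) *\<^sub>R A)) (imat_vec (DF e) (F e)))
             (centered T ^ 2)"
      using alg unfolding computePoincareMap_def Let_def by auto
    have diff: "f differentiable (at x)" for x
    proof -
      have "Ck_on (Suc 0) UNIV f" using sm unfolding smooth_on_def by blast
      then show ?thesis by simp
    qed
    have "invertible B"
      using sec y col sp unfolding poincare_section_def
      by (intro invertible_transversal_frame[of S y first_index]) auto
    then have Af: "A *v f y = axis first_index 1"
      using matrix_inv_column[of B first_index] by (simp add: AB col)
    have DL: "ivl_abs_le (DF e $ i $ j) L" "ivl_abs_le (F e $ j) L" for i j
      using L by (simp_all add: imat_bounded_def ivec_bounded_def ivl_abs_le_def)
    \<comment> \<open>The sign of \<open>L\<close> is not assumed; it follows from the enclosures of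
      the given call.\<close>
    have L0: "0 \<le> L" using ivl_abs_le_nonneg[OF DL(2)] .
    have d0: "0 \<le> d" using bX by (simp add: d_def diameter_ge_0)
    have Dt: "set_of (centered T) = {-r..r}"
      unfolding r_def by (rule set_of_centered)
    then have rle: "ivl_abs_le (centered T) r"
      by (auto simp: ivl_abs_le_def)
    have r0: "0 \<le> r" using ivl_abs_le_nonneg[OF rle] .
    \<comment> \<open>The absolute value allows for negative \<open>K\<close>. The factor 1/2
      between radius and diameter is given away.\<close>
    have "K * d \<le> \<bar>K\<bar> * d" using d0 by (intro mult_right_mono) auto
    then have rK: "r \<le> \<bar>K\<bar> * d"
      using K r0 by (simp add: r_def d_def)
    have c0: "0 \<le> c" and b0: "0 \<le> b"
      using n0 a0 L0 by (simp_all add: c_def b_def)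
    have vb: "\<bar>s - axis first_index 1 $ i\<bar> \<le> c * d" if si: "s \<in> set_of (v $ i)" for s i
    proof -
      obtain u where "u \<in> ivec_set v" "u $ i = s"
        using ivec_set_component[OF si] by blast
      then show ?thesis
        using mean_value_enclosure[OF diff ext bX _ L(1) a, of y u i] v yX
        by (auto simp: Af c_def n_def d_def)
    qed
    have DYb: "ivl_abs_le (DY $ i) (b * r\<^sup>2)" for i
    proof -
      have "ivl_abs_le (imat_vec (DF e) (F e) $ j) (n * (L * L))" for j
        unfolding n_def by (intro ivl_abs_le_imat_vec DL)
      \<comment> \<open>The factor 1/2 in front of \<open>A\<close> is given away.\<close>
      moreover have "ivl_abs_le (imat_of ((1/2) *\<^sub>R A) $ i $ j) a" for i j
        using a[of i j] a0 by (simp add: imat_of_def abs_mult)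
      ultimately have "ivl_abs_le
          (imat_vec (imat_of ((1/2) *\<^sub>R A)) (imat_vec (DF e) (F e)) $ i) b"
        unfolding b_def n_def by - (rule ivl_abs_le_imat_vec)
      then show ?thesis
        unfolding DY ivec_scale_def power2_eq_square
        by (simp add: ivl_abs_le_times rle)
    qed
    \<comment> \<open>Interval scaling treats the components independently, so each one comes with
      its own time \<open>t i\<close>.\<close>
    have "\<forall>i. \<exists>s t q. s \<in> set_of (v $ i) \<and> t \<in> {-r..r} \<and> \<bar>q\<bar> \<le> b * r\<^sup>2 \<and> w $ i = s * t + q"
    proof
      fix i
      have "w $ i \<in> set_of (v $ i * centered T + DY $ i)"
        using w by (simp add: ivec_set_def Y ivec_scale_def)
      then show "\<exists>s t q. s \<in> set_of (v $ i) \<and> t \<in> {-r..r} \<and> \<bar>q\<bar> \<le> b * r\<^sup>2 \<and> w $ i = s * t + q"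
        using ivl_abs_leD[OF DYb] unfolding set_of_plus set_of_times Dt
        by (elim set_plus_elim) blast
    qed
    then obtain s t q where st: "\<And>i. s i \<in> set_of (v $ i)" "\<And>i. t i \<in> {-r..r}"
      "\<And>i. \<bar>q i\<bar> \<le> b * r\<^sup>2" "\<And>i. w $ i = s i * t i + q i"
      by metis
    \<comment> \<open>Only the first component has a first-order part, so its time is the one to
      choose.\<close>
    define \<tau> where "\<tau> = t first_index"
    have "\<bar>(w - \<tau> *\<^sub>R axis first_index 1) $ i\<bar> \<le> (c * \<bar>K\<bar> + b * K\<^sup>2) * d\<^sup>2" for i
    proof -
      \<comment> \<open>For the first index \<open>t i\<close> is \<open>\<tau>\<close>; for the
        others the entry of the unit vector is 0, so their differing times do no harm. The product
        is then a deviation of order \<open>d\<close> times a time of order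
        \<open>d\<close>.\<close>
      have "(w - \<tau> *\<^sub>R axis first_index 1) $ i = (s i - axis first_index 1 $ i) * t i + q i"
        by (simp add: st(4) \<tau>_def axis_def algebra_simps)
      moreover have "\<bar>(s i - axis first_index 1 $ i) * t i\<bar> \<le> c * d * r"
        unfolding abs_mult using vb[OF st(1)] st(2)[of i] c0 d0
        by (intro mult_mono) auto
      ultimately have "\<bar>(w - \<tau> *\<^sub>R axis first_index 1) $ i\<bar> \<le> c * d * r + b * r\<^sup>2"
        using st(3)[of i] by linarith
      also have "\<dots> \<le> c * d * (\<bar>K\<bar> * d) + b * (\<bar>K\<bar> * d)\<^sup>2"
        using rK r0 c0 d0 b0 by (intro add_mono mult_left_mono power_mono) auto
      finally show ?thesis
        by (simp add: power2_eq_square algebra_simps)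
    qed
    then have "norm (w - \<tau> *\<^sub>R axis first_index 1) \<le> n * ((c * \<bar>K\<bar> + b * K\<^sup>2) * d\<^sup>2)"
      unfolding n_def by (rule norm_le_card_component)
    then show "\<exists>\<tau>\<in>set_of (centered T). norm (w - \<tau> *\<^sub>R axis first_index 1)
        \<le> n * (c * \<bar>K\<bar> + b * K\<^sup>2) * (diameter X0)\<^sup>2"
      using st(2) unfolding Dt \<tau>_def d_def by (auto simp: mult.assoc)
  qed
qed

end
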